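(* Let $\Lambda=\Lambda(p,e)\subseteq\mathbb{R}^m$ be a hyperbolicity cone. Let $z\in\Lambda$ satisfy $\operatorname{mult}(z)\ge 1$ and define $r=\operatorname{mult}(z)$. Then $$\nabla p^{(r-1)}(z)\in\mathcal{F}_z^{\Delta}\setminus\{0\}.$$
   Context: A homogeneous polynomial $p:\mathbb{R}^m\to\mathbb{R}$ of degree $d$ is hyperbolic along $e\in\mathbb{R}^m$ if $p(e)\neq 0$ and, for every $x\in\mathbb{R}^m$, the univariate polynomial $t\mapsto p(x-te)$ has only real roots. These roots $\lambda_1(x)\ge\cdots\ge\lambda_d(x)$ (with multiplicity) are the eigenvalues of $x$, and $\Lambda(p,e)=\{x\in\mathbb{R}^m\mid\lambda_d(x)\ge 0\}$ is the hyperbolicity cone of $p$ along $e$, a closed convex cone. $\operatorname{mult}(x)$ is the number of zero eigenvalues of $x$, i.e. the multiplicity of $0$ as a root of $t\mapsto p(x-te)$. $p^{(i)}$ denotes the $i$-th directional derivative of $p$ along $e$: $p^{(0)}=p$ and $p^{(i)}(x)=\frac{d^i}{dt^i}p(x+te)\big|_{t=0}$. $\mathbb{R}^m$ carries an inner product $\langle\cdot,\cdot\rangle$, with respect to which gradients and dual cones are taken: $\Lambda^*=\{y\in\mathbb{R}^m\mid\langle x,y\rangle\ge0\ \forall x\in\Lambda\}$. For $z\in\Lambda$, $\mathcal{F}_z^{\Delta}=\{y\in\Lambda^*\mid\langle y,z\rangle=0\}$ is the set of elements conjugate to $z$.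
   Formalization: The formal statement assumes p(e) > 0 instead of p(e) ≠ 0; for p(e) < 0 the claim is false, since the gradient changes sign while Λ does not (e.g. p = −x₁x₂, e = (1,1), z = (1,0)). *)

theory Defs
  imports "HOL-Analysis.Analysis" "HOL-Computational_Algebra.Polynomial"
begin

text \<open>
  The ambient space is an arbitrary type of class \<open>euclidean_space\<close>, i.e. an arbitrary
  finite-dimensional real inner product space; gradients and dual cones refer to its inner product.
  \<open>Basis\<close> only serves to write polynomials in coordinates; the notion of a homogeneous polynomial
  of degree \<open>d\<close> does not depend on the choice of linear coordinates.
\<close>

definition homogeneous_polynomial :: "nat \<Rightarrow> ('a::euclidean_space \<Rightarrow> real) \<Rightarrow> bool" where
  "homogeneous_polynomial d p \<longleftrightarrow>
     (\<exists>(A :: ('a \<Rightarrow> nat) set) (c :: ('a \<Rightarrow> nat) \<Rightarrow> real).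
        finite A \<and> (\<forall>\<alpha>\<in>A. (\<Sum>b\<in>Basis. \<alpha> b) = d) \<and>
        (\<forall>x. p x = (\<Sum>\<alpha>\<in>A. c \<alpha> * (\<Prod>b\<in>Basis. (x \<bullet> b) ^ \<alpha> b))))"

text \<open>
  The univariate polynomial \<open>t \<mapsto> p (x - t e)\<close> as an element of \<open>real poly\<close>; it exists
  and is unique for polynomial \<open>p\<close> (lemma \<open>poly_line_poly\<close> below).
\<close>

definition line_poly :: "('a::euclidean_space \<Rightarrow> real) \<Rightarrow> 'a \<Rightarrow> 'a \<Rightarrow> real poly" where
  "line_poly p e x = (THE q. \<forall>t. poly q t = p (x - t *\<^sub>R e))"

lemma poly_line_poly:
  fixes p :: "'a::euclidean_space \<Rightarrow> real"
  assumes "homogeneous_polynomial d p"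
  shows "poly (line_poly p e x) t = p (x - t *\<^sub>R e)"
proof -
  obtain A :: "('a \<Rightarrow> nat) set" and c where
    p: "\<And>x. p x = (\<Sum>\<alpha>\<in>A. c \<alpha> * (\<Prod>b\<in>Basis. (x \<bullet> b) ^ \<alpha> b))"
    using assms unfolding homogeneous_polynomial_def by blast
  define q where
    "q = (\<Sum>\<alpha>\<in>A. smult (c \<alpha>) (\<Prod>b\<in>Basis. [:x \<bullet> b, - (e \<bullet> b):] ^ \<alpha> b))"
  have q: "\<forall>t. poly q t = p (x - t *\<^sub>R e)"
    by (simp add: q_def p poly_sum poly_prod inner_diff_left)
  have "line_poly p e x = q"
    unfolding line_poly_def
  proof (rule the_equality)
    show "q' = q" if "\<forall>t. poly q' t = p (x - t *\<^sub>R e)" for q'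
    proof -
      have "poly q' = poly q"
        using that q by (intro ext) simp
      then show ?thesis
        by (simp only: poly_eq_poly_eq_iff)
    qed
  qed (rule q)
  with q show ?thesis by simp
qed

text \<open>Having only real roots means that all \<^emph>\<open>complex\<close> roots are real.\<close>

definition only_real_roots :: "real poly \<Rightarrow> bool" where
  "only_real_roots q \<longleftrightarrow> (\<forall>w :: complex. poly (map_poly of_real q) w = 0 \<longrightarrow> w \<in> \<real>)"

definition hyperbolic :: "nat \<Rightarrow> ('a::euclidean_space \<Rightarrow> real) \<Rightarrow> 'a \<Rightarrow> bool" where
  "hyperbolic d p e \<longleftrightarrow>
     homogeneous_polynomial d p \<and> p e \<noteq> 0 \<and> (\<forall>x. only_real_roots (line_poly p e x))"

definition eigenvalues :: "('a::euclidean_space \<Rightarrow> real) \<Rightarrow> 'a \<Rightarrow> 'a \<Rightarrow> real multiset" where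
  "eigenvalues p e x = proots (line_poly p e x)"

text \<open>
  The \<open>k\<close>-th largest eigenvalue, counted from \<open>k = 1\<close>; meaningful for \<open>1 \<le> k \<le> d\<close>
  if \<open>p\<close> is hyperbolic of degree \<open>d\<close>.
\<close>

definition eigenvalue :: "('a::euclidean_space \<Rightarrow> real) \<Rightarrow> 'a \<Rightarrow> nat \<Rightarrow> 'a \<Rightarrow> real" where
  "eigenvalue p e k x = rev (sorted_list_of_multiset (eigenvalues p e x)) ! (k - 1)"

definition hyp_cone :: "nat \<Rightarrow> ('a::euclidean_space \<Rightarrow> real) \<Rightarrow> 'a \<Rightarrow> 'a set" where
  "hyp_cone d p e = {x. eigenvalue p e d x \<ge> 0}"

definition hyp_mult :: "('a::euclidean_space \<Rightarrow> real) \<Rightarrow> 'a \<Rightarrow> 'a \<Rightarrow> nat" where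
  "hyp_mult p e x = count (eigenvalues p e x) 0"

definition dir_deriv :: "'a::euclidean_space \<Rightarrow> nat \<Rightarrow> ('a \<Rightarrow> real) \<Rightarrow> 'a \<Rightarrow> real" where
  "dir_deriv e i p x = (deriv ^^ i) (\<lambda>t. p (x + t *\<^sub>R e)) 0"

definition gradient :: "('a::euclidean_space \<Rightarrow> real) \<Rightarrow> 'a \<Rightarrow> 'a" where
  "gradient f x = (THE D. GDERIV f x :> D)"

lemma gradient_eqI:
  assumes "GDERIV f x :> D"
  shows "gradient f x = D"
  unfolding gradient_def
proof (rule the_equality)
  fix D' assume "GDERIV f x :> D'"
  then have "(\<lambda>h. h \<bullet> D') = (\<lambda>h. h \<bullet> D)"
    using assms unfolding gderiv_def by (rule has_derivative_unique)
  then have "\<forall>h. h \<bullet> D' = h \<bullet> D"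
    by (intro allI) (rule fun_cong)
  then show "D' = D"
    by (simp only: vector_eq_ldot)
qed (rule assms)

definition dual_cone :: "'a::euclidean_space set \<Rightarrow> 'a set" where
  "dual_cone K = {y. \<forall>x\<in>K. x \<bullet> y \<ge> 0}"

definition conjugate_face :: "'a::euclidean_space set \<Rightarrow> 'a \<Rightarrow> 'a set" where
  "conjugate_face K z = {y \<in> dual_cone K. y \<bullet> z = 0}"

end

theory Submission
  imports Defs "HOL-Computational_Algebra.Fundamental_Theorem_Algebra"
begin

text \<open>
  Along \<open>e\<close>, a point of the hyperbolicity cone gives a real-rooted univariate polynomial without
  positive roots, so all its coefficients, that is the derivatives of \<open>p\<close> along \<open>e\<close>, are nonnegative
  on the cone. Since the cone is convex, the derivative of order \<open>r - 1\<close> is nonnegative on \<open>z + s x\<close> for every \<open>x\<close> in the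
  cone and \<open>s \<ge> 0\<close>; it vanishes at \<open>z\<close>, so its derivative at \<open>z\<close> in direction \<open>x\<close> is nonnegative.
  The direction \<open>- z\<close> is admissible as well because the cone contains \<open>(1 - s) z\<close>, and the
  direction \<open>e\<close> gives the derivative of order \<open>r\<close> at \<open>z\<close>, which is nonzero. Convexity is Garding's theorem, proved by moving the zeros of
  univariate complex polynomials along a homotopy that never crosses the real axis.
\<close>

section \<open>Real-rooted polynomials\<close>

lemma map_poly_of_real_mult:
  "map_poly of_real (p * q) = (map_poly of_real p * map_poly of_real q :: 'a::{real_algebra_1,comm_ring_1} poly)"
  by (rule poly_eqI) (simp add: coeff_map_poly coeff_mult)

lemma poly_map_poly_of_real:
  "poly (map_poly of_real p) (of_real t :: 'a::{real_algebra_1,comm_ring_1}) = of_real (poly p t)"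
  by (induction p) (simp_all add: map_poly_pCons)

lemma only_real_roots_factor:
  assumes "only_real_roots (p * q)"
  shows "only_real_roots q"
  using assms by (auto simp: only_real_roots_def map_poly_of_real_mult)

lemma only_real_roots_imp_root:
  assumes "only_real_roots q" and "degree q > 0"
  obtains a where "poly q a = 0"
proof -
  have "degree (map_poly of_real q :: complex poly) = degree q"
    by (rule degree_map_poly) simp
  then have "\<not> constant (poly (map_poly of_real q :: complex poly))"
    using assms(2) by (simp add: constant_degree)
  then obtain w :: complex where w: "poly (map_poly of_real q) w = 0"
    using fundamental_theorem_of_algebra by blast
  then have "w \<in> \<real>"
    using assms(1) by (auto simp: only_real_roots_def)
  then obtain a where "w = of_real a"
    by (auto elim: Reals_cases)
  with w have "poly q a = 0"
    by (simp add: poly_map_poly_of_real)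
  then show ?thesis by (rule that)
qed

text \<open>By the fundamental theorem of algebra a nonconstant real-rooted polynomial has a real
  root, and the cofactor of its linear factor is again real-rooted.\<close>

lemma only_real_roots_induct [consumes 1, case_names const root]:
  assumes "only_real_roots q"
    and const: "\<And>c. P [:c:]"
    and root: "\<And>a q. q \<noteq> 0 \<Longrightarrow> only_real_roots q \<Longrightarrow> P q \<Longrightarrow> P ([:- a, 1:] * q)"
  shows "P q"
  using assms(1)
proof (induction "degree q" arbitrary: q)
  case 0
  then obtain c where "q = [:c:]"
    by (metis degree_eq_zeroE)
  then show ?case by (simp add: const)
next
  case (Suc n)
  then obtain a where "poly q a = 0"
    using only_real_roots_imp_root by (metis zero_less_Suc)
  then obtain q' where q': "q = [:- a, 1:] * q'"
    by (metis poly_eq_0_iff_dvd dvdE)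
  have "q' \<noteq> 0"
    using Suc.hyps(2) q' by auto
  then have "degree q = Suc (degree q')"
    unfolding q' by (subst degree_mult_eq) auto
  moreover have "only_real_roots q'"
    using Suc.prems unfolding q' by (rule only_real_roots_factor)
  moreover have "P q'"
    using calculation Suc.hyps by simp
  ultimately show ?case
    unfolding q' using \<open>q' \<noteq> 0\<close> by (intro root)
qed

text \<open>For d >= 1 this puts the position \<open>d - 1\<close>, where \<open>eigenvalue\<close>
  reads off the smallest eigenvalue, inside the list.\<close>

lemma size_proots_only_real_roots:
  assumes "only_real_roots q"
  shows "size (proots q) = degree q"
  using assms
proof (induction rule: only_real_roots_induct)
  case (root a q)
  then have "proots ([:- a, 1:] * q) = {#a#} + proots q"
    by (subst proots_mult) auto
  moreover have "degree ([:- a, 1:] * q) = Suc (degree q)"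
    using root by (subst degree_mult_eq) auto
  ultimately show ?case using root by simp
qed auto

text \<open>All roots are nonpositive, so every linear factor, and hence the product, has
  nonnegative coefficients.\<close>

lemma only_real_roots_coeff_nonneg:
  assumes "only_real_roots q" and "\<And>t. t > 0 \<Longrightarrow> poly q t \<noteq> 0" and "lead_coeff q \<ge> 0"
  shows "coeff q k \<ge> 0"
  using assms
proof (induction arbitrary: k rule: only_real_roots_induct)
  case (const c)
  then show ?case by (auto simp: coeff_pCons split: nat.split)
next
  case (root a q)
  have "a \<le> 0"
    using root.prems(1)[of a] by force
  moreover have "coeff q j \<ge> 0" for j
  proof (rule root.IH)
    show "poly q t \<noteq> 0" if "t > 0" for t
      using root.prems(1)[OF that] by auto
    show "lead_coeff q \<ge> 0"
      using root.prems(2) by (subst (asm) lead_coeff_mult) auto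
  qed
  ultimately show ?case
    by (auto simp: coeff_pCons split: nat.split intro: mult_nonpos_nonneg order.trans[OF mult_nonpos_nonneg])
qed

section \<open>Homogeneous forms along lines\<close>

text \<open>The coordinates take values in a field \<open>'k\<close> because the real space has no
  complex points; for complex \<open>'k\<close> this is the complexification of the
  polynomial.\<close>

definition form :: "('b::euclidean_space \<Rightarrow> nat) set \<Rightarrow> (('b \<Rightarrow> nat) \<Rightarrow> real) \<Rightarrow> ('b \<Rightarrow> 'k::real_normed_field) \<Rightarrow> 'k"
  where "form A c \<zeta> = (\<Sum>\<alpha>\<in>A. of_real (c \<alpha>) * (\<Prod>b\<in>Basis. \<zeta> b ^ \<alpha> b))"

definition form_line_poly ::
  "('b::euclidean_space \<Rightarrow> nat) set \<Rightarrow> (('b \<Rightarrow> nat) \<Rightarrow> real) \<Rightarrow> ('b \<Rightarrow> 'k::real_normed_field) \<Rightarrow> ('b \<Rightarrow> 'k) \<Rightarrow> 'k poly"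
  where "form_line_poly A c \<zeta> \<xi> = (\<Sum>\<alpha>\<in>A. smult (of_real (c \<alpha>)) (\<Prod>b\<in>Basis. [:\<zeta> b, \<xi> b:] ^ \<alpha> b))"

lemma poly_form_line_poly:
  "poly (form_line_poly A c \<zeta> \<xi>) w = form A c (\<lambda>b. \<zeta> b + w * \<xi> b)"
  by (simp add: form_line_poly_def form_def poly_sum poly_prod)

lemma form_of_real:
  "form A c (\<lambda>b. of_real (f b)) = (of_real (form A c f) :: 'k::real_normed_field)"
  by (simp add: form_def)

text \<open>Both sides agree at every embedded real number, hence at infinitely many points.\<close>

lemma map_poly_form_line_poly:
  fixes f g :: "'b::euclidean_space \<Rightarrow> real"
  shows "map_poly of_real (form_line_poly A c f g) =
    (form_line_poly A c (\<lambda>b. of_real (f b)) (\<lambda>b. of_real (g b)) :: 'k::real_normed_field poly)"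
    (is "?P = ?Q")
proof (rule ccontr)
  assume "?P \<noteq> ?Q"
  then have "finite {w. poly (?P - ?Q) w = 0}"
    by (intro poly_roots_finite) simp
  moreover have "range of_real \<subseteq> {w. poly (?P - ?Q) w = 0}"
    by (auto simp: poly_map_poly_of_real poly_form_line_poly simp flip: form_of_real)
  ultimately have "finite (range (of_real :: real \<Rightarrow> 'k))"
    by (rule finite_subset [rotated])
  then show False
    by (auto simp: finite_image_iff inj_def infinite_UNIV_char_0)
qed

lemma form_scale:
  assumes "\<And>\<alpha>. \<alpha> \<in> A \<Longrightarrow> (\<Sum>b\<in>Basis. \<alpha> b) = d"
  shows "form A c (\<lambda>b. k * \<zeta> b) = k ^ d * form A c \<zeta>"
proof -
  have "(\<Prod>b\<in>Basis. (k * \<zeta> b) ^ \<alpha> b) = k ^ d * (\<Prod>b\<in>Basis. \<zeta> b ^ \<alpha> b)" if "\<alpha> \<in> A" for \<alpha>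
    using assms[OF that] by (simp add: power_mult_distrib prod.distrib flip: power_sum)
  then show ?thesis
    by (simp add: form_def sum_distrib_left mult_ac)
qed

text \<open>Here \<open>m\<close> and \<open>n\<close> only bound the degrees. The top coefficients
  may vanish, so they cannot be replaced by \<open>lead_coeff\<close>.\<close>

lemma coeff_mult_top:
  assumes "degree f \<le> m" and "degree g \<le> n"
  shows "coeff (f * g) (m + n) = coeff f m * coeff g n"
proof -
  have "coeff (f * g) (m + n) = (\<Sum>i\<le>m + n. coeff f i * coeff g (m + n - i))"
    by (simp add: coeff_mult)
  also have "\<dots> = (\<Sum>i\<in>{m}. coeff f i * coeff g (m + n - i))"
  proof (rule sum.mono_neutral_right)
    show "\<forall>i\<in>{..m + n} - {m}. coeff f i * coeff g (m + n - i) = 0"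
    proof
      fix i assume "i \<in> {..m + n} - {m}"
      then have "i > m \<or> m + n - i > n" by auto
      then show "coeff f i * coeff g (m + n - i) = 0"
        using assms by (auto simp: coeff_eq_0)
    qed
  qed auto
  finally show ?thesis by simp
qed

lemma degree_coeff_power_top:
  assumes "degree f \<le> m"
  shows "degree (f ^ n) \<le> m * n \<and> coeff (f ^ n) (m * n) = coeff f m ^ n"
proof (induction n)
  case (Suc n)
  then show ?case
    using assms coeff_mult_top[of f m "f ^ n" "m * n"] degree_mult_le[of f "f ^ n"] by auto
qed auto

lemma degree_coeff_prod_top:
  assumes "finite B" and "\<And>b. b \<in> B \<Longrightarrow> degree (f b) \<le> n b"
  shows "degree (\<Prod>b\<in>B. f b) \<le> (\<Sum>b\<in>B. n b) \<and>
    coeff (\<Prod>b\<in>B. f b) (\<Sum>b\<in>B. n b) = (\<Prod>b\<in>B. coeff (f b) (n b))"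
  using assms
proof (induction rule: finite_induct)
  case (insert b B)
  then show ?case
    using coeff_mult_top[of "f b" "n b" "\<Prod>b\<in>B. f b" "\<Sum>b\<in>B. n b"]
      degree_mult_le[of "f b" "\<Prod>b\<in>B. f b"]
    by (auto intro: order.trans[OF _ add_mono])
qed auto

text \<open>Each linear factor contributes its slope. The top coefficient thus depends on
  \<open>\<xi>\<close> alone and stays fixed while \<open>\<zeta>\<close> moves along a
  homotopy.\<close>

lemma form_line_poly_top:
  assumes "\<And>\<alpha>. \<alpha> \<in> A \<Longrightarrow> (\<Sum>b\<in>Basis. \<alpha> b) = d"
  shows "degree (form_line_poly A c \<zeta> \<xi>) \<le> d" and "coeff (form_line_poly A c \<zeta> \<xi>) d = form A c \<xi>"
proof -
  have "degree ([:\<zeta> b, \<xi> b:] ^ n) \<le> n \<and> coeff ([:\<zeta> b, \<xi> b:] ^ n) n = \<xi> b ^ n" for b n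
    using degree_coeff_power_top[of "[:\<zeta> b, \<xi> b:]" 1 n] by simp
  then have *: "degree (\<Prod>b\<in>Basis. [:\<zeta> b, \<xi> b:] ^ \<alpha> b) \<le> d \<and>
      coeff (\<Prod>b\<in>Basis. [:\<zeta> b, \<xi> b:] ^ \<alpha> b) d = (\<Prod>b\<in>Basis. \<xi> b ^ \<alpha> b)" if "\<alpha> \<in> A" for \<alpha>
    using degree_coeff_prod_top[of Basis "\<lambda>b. [:\<zeta> b, \<xi> b:] ^ \<alpha> b" \<alpha>] assms[OF that] by simp
  show "degree (form_line_poly A c \<zeta> \<xi>) \<le> d"
  proof (intro degree_le allI impI)
    fix i assume "i > d"
    then have "coeff (\<Prod>b\<in>Basis. [:\<zeta> b, \<xi> b:] ^ \<alpha> b) i = 0" if "\<alpha> \<in> A" for \<alpha>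
      using *[OF that] by (intro coeff_eq_0) auto
    then show "coeff (form_line_poly A c \<zeta> \<xi>) i = 0"
      by (simp add: form_line_poly_def coeff_sum)
  qed
  show "coeff (form_line_poly A c \<zeta> \<xi>) d = form A c \<xi>"
    using * by (simp add: form_line_poly_def form_def coeff_sum)
qed

text \<open>The coefficients arise from the coordinates by sums and products. \<open>C\<close> is
  later taken to be continuity on the unit interval and differentiability at a point.\<close>

lemma coeff_form_line_poly_closed:
  assumes const: "\<And>a. C (\<lambda>_. a)"
    and add: "\<And>f g. C f \<Longrightarrow> C g \<Longrightarrow> C (\<lambda>s. f s + g s)"
    and mult: "\<And>f g. C f \<Longrightarrow> C g \<Longrightarrow> C (\<lambda>s. f s * g s)"
    and coords: "\<And>b. C (\<lambda>s. \<zeta> s b)" "\<And>b. C (\<lambda>s. \<xi> s b)"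
  shows "C (\<lambda>s. coeff (form_line_poly A c (\<zeta> s) (\<xi> s)) k)"
proof -
  have sum: "C (\<lambda>s. \<Sum>i\<in>I. f i s)" if "\<And>i. C (f i)" for f and I :: "'i set"
    by (induction I rule: infinite_finite_induct) (auto intro: const add that)
  have poly_mult: "\<forall>k. C (\<lambda>s. coeff (P s * Q s) k)"
    if "\<forall>k. C (\<lambda>s. coeff (P s) k)" "\<forall>k. C (\<lambda>s. coeff (Q s) k)" for P Q
    using that by (auto simp: coeff_mult intro!: sum mult)
  have one: "\<forall>k. C (\<lambda>s. coeff 1 k)"
    by (auto intro: const)
  have pow: "\<forall>k. C (\<lambda>s. coeff (P s ^ n) k)" if "\<forall>k. C (\<lambda>s. coeff (P s) k)" for P n
    by (induction n) (use one poly_mult that in \<open>simp_all\<close>)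
  have linear: "\<forall>k. C (\<lambda>s. coeff [:\<zeta> s b, \<xi> s b:] k)" for b
  proof
    show "C (\<lambda>s. coeff [:\<zeta> s b, \<xi> s b:] k)" for k
      by (cases k; cases "k - 1") (auto simp: coords const)
  qed
  have prod: "\<forall>k. C (\<lambda>s. coeff (\<Prod>b\<in>B. [:\<zeta> s b, \<xi> s b:] ^ \<alpha> b) k)" for B \<alpha>
    by (induction B rule: infinite_finite_induct) (use one poly_mult pow linear in \<open>simp_all\<close>)
  then have "C (\<lambda>s. of_real (c \<alpha>) * coeff (\<Prod>b\<in>Basis. [:\<zeta> s b, \<xi> s b:] ^ \<alpha> b) k)" for \<alpha>
    by (intro mult const) auto
  then have "C (\<lambda>s. \<Sum>\<alpha>\<in>A. of_real (c \<alpha>) * coeff (\<Prod>b\<in>Basis. [:\<zeta> s b, \<xi> s b:] ^ \<alpha> b) k)"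
    by (rule sum)
  then show ?thesis
    by (simp add: form_line_poly_def coeff_sum)
qed

section \<open>Polynomials without zeros in the upper half-plane\<close>

text \<open>Cauchy's root bound: for norm w > 1 the lower terms add up to at most
  \<open>M * norm w ^ (d - 1)\<close>. The bound depends only on \<open>M\<close> and
  \<open>l\<close>, so it confines the zeros of a whole family to one disc.\<close>

lemma norm_root_le:
  fixes q :: "complex poly"
  assumes "degree q \<le> d" and "coeff q d = l" and "l \<noteq> 0" and "poly q w = 0"
    and "(\<Sum>k<d. norm (coeff q k)) \<le> M"
  shows "norm w \<le> max 1 (M / norm l)"
proof (rule ccontr)
  assume "\<not> ?thesis"
  then have w: "norm w > 1" "norm w > M / norm l" by auto
  have deg: "degree q = d"
    using assms by (metis le_degree order_antisym)
  have d: "d > 0"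
    using assms deg by (cases d) (auto elim!: degree_eq_zeroE)
  have "poly q w = (\<Sum>k<d. coeff q k * w ^ k) + l * w ^ d"
    using assms deg by (simp add: poly_altdef lessThan_Suc_atMost [symmetric])
  then have "l * w ^ d = - (\<Sum>k<d. coeff q k * w ^ k)"
    using assms by (simp add: add_eq_0_iff2)
  then have "norm l * norm w ^ d = norm (\<Sum>k<d. coeff q k * w ^ k)"
    by (simp flip: norm_mult norm_power)
  also have "\<dots> \<le> (\<Sum>k<d. norm (coeff q k) * norm w ^ (d - 1))"
    using w by (intro sum_norm_le) (auto simp: norm_mult norm_power intro!: mult_left_mono power_increasing)
  also have "\<dots> = (\<Sum>k<d. norm (coeff q k)) * norm w ^ (d - 1)"
    by (simp add: sum_distrib_right)
  also have "\<dots> \<le> M * norm w ^ (d - 1)"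
    using assms by (intro mult_right_mono) auto
  also have "norm l * norm w ^ d = norm l * norm w * norm w ^ (d - 1)"
    using d by (simp add: power_eq_if)
  finally have "norm l * norm w \<le> M"
    by (rule mult_right_le_imp_le) (rule zero_less_power, use w in linarith)
  then show False
    using w assms by (simp add: field_simps)
qed

text \<open>Every root \<open>x\<close> lies strictly below the real axis, so each factor satisfies
  norm (w - x) >= Im (w - x) >= Im w.\<close>

lemma norm_poly_ge_Im_power:
  fixes q :: "complex poly"
  assumes "\<And>w. Im w \<ge> 0 \<Longrightarrow> poly q w \<noteq> 0" and "Im w \<ge> 0"
  shows "norm (poly q w) \<ge> norm (lead_coeff q) * Im w ^ degree q"
proof -
  have "norm (\<Prod>x\<in>#S. w - x) \<ge> Im w ^ size S" if "\<forall>x\<in>#S. Im x < 0" for S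
    using that
  proof (induction S)
    case (add x S)
    have "Im w \<le> Im (w - x)" using add.prems by simp
    also have "\<dots> \<le> norm (w - x)" by (metis abs_Im_le_cmod abs_le_D1)
    finally show ?case
      using add assms(2) by (auto simp: norm_mult intro!: mult_mono)
  qed auto
  moreover have "\<forall>x\<in>#proots q. Im x < 0"
    using assms(1) by (metis (mono_tags, lifting) linorder_not_less mem_Collect_eq poly_0 set_count_proots)
  ultimately have "norm (\<Prod>x\<in>#proots q. w - x) \<ge> Im w ^ degree q"
    by (metis size_proots_complex)
  moreover have "poly q w = lead_coeff q * (\<Prod>x\<in>#proots q. w - x)"
    by (subst complex_poly_decompose_multiset [symmetric]) (simp add: poly_prod_mset)
  ultimately show ?thesis
    by (simp add: norm_mult mult_left_mono)
qed

text \<open>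
  The parameters \<open>\<tau>\<close> for which \<open>Q \<tau>\<close> has a zero in the closed upper half-plane form a closed set
  because zeros stay bounded. The others do as well, because if all zeros lie below the real axis,
  \<open>Q \<tau>\<close> is bounded below by \<open>norm l * Im w ^ d\<close>, which persists in the limit.
\<close>

lemma upper_half_plane_homotopy:
  fixes Q :: "real \<Rightarrow> complex poly"
  assumes deg: "\<And>\<tau>. degree (Q \<tau>) \<le> d" and lead: "\<And>\<tau>. coeff (Q \<tau>) d = l" and "l \<noteq> 0"
    and cont: "\<And>k. continuous_on {0..1} (\<lambda>\<tau>. coeff (Q \<tau>) k)"
    and real: "\<And>\<tau> s. \<tau> \<in> {0..1} \<Longrightarrow> poly (Q \<tau>) (of_real s) \<noteq> 0"
    and start: "\<And>w. Im w \<ge> 0 \<Longrightarrow> poly (Q 0) w \<noteq> 0"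
    and "Im w \<ge> 0"
  shows "poly (Q 1) w \<noteq> 0"
proof -
  have deg': "degree (Q \<tau>) = d" for \<tau>
    using deg lead \<open>l \<noteq> 0\<close> by (metis le_degree order_antisym)
  have F: "poly (Q \<tau>) w = (\<Sum>k\<le>d. coeff (Q \<tau>) k * w ^ k)" for \<tau> w
    by (simp add: poly_altdef deg')
  have contF: "continuous_on ({0..1} \<times> UNIV) (\<lambda>(\<tau>, w). poly (Q \<tau>) w)"
  proof -
    have "continuous_on ({0..1} \<times> UNIV) (\<lambda>x. coeff (Q (fst x)) k)" for k
      by (rule continuous_on_compose2[OF cont]) (auto intro: continuous_intros)
    then show ?thesis
      unfolding F case_prod_beta by (intro continuous_intros)
  qed
  define T where "T = {\<tau>\<in>{0..1}. \<forall>w. Im w \<ge> 0 \<longrightarrow> poly (Q \<tau>) w \<noteq> 0}"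
  define S where "S = {\<tau>\<in>{0..1}. \<exists>w. Im w \<ge> 0 \<and> poly (Q \<tau>) w = 0}"
  have "closed S"
  proof -
    have "continuous_on {0..1} (\<lambda>\<tau>. \<Sum>k<d. norm (coeff (Q \<tau>) k))"
      by (intro continuous_intros cont)
    then have "compact ((\<lambda>\<tau>. \<Sum>k<d. norm (coeff (Q \<tau>) k)) ` {0..1})"
      by (intro compact_continuous_image) auto
    then obtain M where M: "\<And>\<tau>. \<tau> \<in> {0..1} \<Longrightarrow> (\<Sum>k<d. norm (coeff (Q \<tau>) k)) \<le> M"
      by (meson bounded_imp_bdd_above bdd_above.E compact_imp_bounded imageI)
    define B where "B = max 1 (M / norm l)"
    \<comment> \<open>The set of pairs of a parameter and a zero is compact because zeros have norm
      at most \<open>B\<close>; \<open>S\<close> is its projection.\<close>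
    define K where "K = {x \<in> {0..1} \<times> (cball 0 B \<inter> {w. Im w \<ge> 0}). (\<lambda>(\<tau>, w). poly (Q \<tau>) w) x = 0}"
    have comp: "compact ({0..1::real} \<times> (cball (0::complex) B \<inter> {w. Im w \<ge> 0}))"
      by (intro compact_Times compact_Int_closed closed_halfspace_Im_ge) auto
    have "closedin (top_of_set ({0..1} \<times> (cball 0 B \<inter> {w. Im w \<ge> 0}))) K"
      unfolding K_def by (rule continuous_closedin_preimage_constant, rule continuous_on_subset[OF contF]) auto
    with comp have "compact K"
      by (rule closedin_compact)
    then have "compact (fst ` K)"
      by (intro compact_continuous_image continuous_intros)
    moreover have "fst ` K = S"
    proof
      show "S \<subseteq> fst ` K"
      proof
        fix \<tau> assume "\<tau> \<in> S"
        then obtain w where w: "\<tau> \<in> {0..1}" "Im w \<ge> 0" "poly (Q \<tau>) w = 0"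
          by (auto simp: S_def)
        then have "norm w \<le> B"
          unfolding B_def using deg lead \<open>l \<noteq> 0\<close> M by (intro norm_root_le[of "Q \<tau>" d]) auto
        with w have "(\<tau>, w) \<in> K"
          by (simp add: K_def)
        then show "\<tau> \<in> fst ` K" by (rule image_eqI[rotated]) simp
      qed
    qed (auto simp: K_def S_def)
    ultimately show ?thesis
      by (simp add: compact_imp_closed)
  qed
  moreover have "closed T"
  proof -
    \<comment> \<open>An intersection of closed conditions, one for each \<open>w\<close>.\<close>
    have "T = (\<Inter>w\<in>{w. Im w \<ge> 0}. {\<tau>\<in>{0..1}. norm l * Im w ^ d \<le> norm (poly (Q \<tau>) w)})"
    proof (intro equalityI subsetI)
      fix \<tau> assume "\<tau> \<in> T"
      then show "\<tau> \<in> (\<Inter>w\<in>{w. Im w \<ge> 0}. {\<tau>\<in>{0..1}. norm l * Im w ^ d \<le> norm (poly (Q \<tau>) w)})"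
        using norm_poly_ge_Im_power[of "Q \<tau>"] by (auto simp: T_def deg' lead)
    next
      fix \<tau> assume "\<tau> \<in> (\<Inter>w\<in>{w. Im w \<ge> 0}. {\<tau>\<in>{0..1}. norm l * Im w ^ d \<le> norm (poly (Q \<tau>) w)})"
      then have *: "\<tau> \<in> {0..1} \<and> norm l * Im w ^ d \<le> norm (poly (Q \<tau>) w)" if "Im w \<ge> 0" for w
        using that by blast
      have \<tau>: "\<tau> \<in> {0..1}"
        using *[of 0] by simp
      have bound: "norm l * Im w ^ d \<le> norm (poly (Q \<tau>) w)" if "Im w \<ge> 0" for w
        using *[OF that] by blast
      have "poly (Q \<tau>) w \<noteq> 0" if "Im w \<ge> 0" for w
      \<comment> \<open>The lower bound is used only for Im w > 0, where it is positive; on the real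
        axis zeros are excluded by \<open>real\<close>.\<close>
      proof (cases "Im w = 0")
        case True
        then have "w = of_real (Re w)" by (simp add: complex_eq_iff)
        then show ?thesis using real[OF \<tau>] by metis
      next
        case False
        then have "norm l * Im w ^ d > 0"
          using that \<open>l \<noteq> 0\<close> by simp
        then show ?thesis using bound[OF that] by auto
      qed
      with \<tau> show "\<tau> \<in> T" by (auto simp: T_def)
    qed
    moreover have "closed {\<tau>\<in>{0..1}. norm l * Im w ^ d \<le> norm (poly (Q \<tau>) w)}" for w
    proof (rule continuous_on_closed_Collect_le)
      show "continuous_on {0..1} (\<lambda>\<tau>. norm (poly (Q \<tau>) w))"
        unfolding F by (intro continuous_intros cont)
    qed (auto intro: continuous_intros)
    ultimately show ?thesis by auto
  qed
  moreover have "{0..1} \<subseteq> S \<union> T" "S \<inter> T \<inter> {0..1} = {}"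
    by (auto simp: S_def T_def)
  moreover have "0 \<in> T"
    using start by (auto simp: T_def)
  \<comment> \<open>The connected interval is covered by two disjoint closed sets, and
    \<open>T\<close> contains 0.\<close>
  ultimately have "S \<inter> {0..1} = {}"
    using connected_closedD[of "{0..1::real}" S T] by (auto simp: disjoint_iff)
  then have "1 \<notin> S" by auto
  with \<open>Im w \<ge> 0\<close> show ?thesis
    by (auto simp: S_def)
qed

section \<open>The hyperbolicity cone is convex\<close>

text \<open>The condition \<open>p e > 0\<close> fixes a sign: passing from p to -p keeps the
  eigenvalues and negates the gradients. Lines are written as x + w e, so the zeros are the
  negatives of the eigenvalues.\<close>

locale hyperbolic_form =
  fixes A :: "('a::euclidean_space \<Rightarrow> nat) set" and c :: "('a \<Rightarrow> nat) \<Rightarrow> real"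
    and d :: nat and p :: "'a \<Rightarrow> real" and e :: 'a
  assumes homogeneous: "\<And>\<alpha>. \<alpha> \<in> A \<Longrightarrow> (\<Sum>b\<in>Basis. \<alpha> b) = d"
    and p_eq: "\<And>x. p x = form A c (\<lambda>b. x \<bullet> b)"
    and p_e_pos: "p e > 0"
    and real_zeros: "\<And>x w :: complex.
      form A c (\<lambda>b. of_real (x \<bullet> b) + w * of_real (e \<bullet> b)) = 0 \<Longrightarrow> w \<in> \<real>"
begin

text \<open>A zero at \<open>x + t *\<^sub>R e\<close> means that -t is an eigenvalue of x, so this
  says that no eigenvalue is negative. In \<open>open_cone\<close> the eigenvalue 0 is excluded
  too.\<close>

definition cone :: "'a set" where
  "cone = {x. \<forall>t>0. p (x + t *\<^sub>R e) \<noteq> 0}"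

definition open_cone :: "'a set" where
  "open_cone = {x. \<forall>t\<ge>0. p (x + t *\<^sub>R e) \<noteq> 0}"

section \<open>Zero-free regions of the complexified form\<close>

lemma form_of_real_inner: "form A c (\<lambda>b. of_real (x \<bullet> b)) = (of_real (p x) :: complex)"
  by (simp add: p_eq form_of_real)

lemma p_scale: "p (k *\<^sub>R x) = k ^ d * p x"
  using form_scale[where A = A and c = c and k = k and \<zeta> = "\<lambda>b. x \<bullet> b", OF homogeneous]
  by (simp add: p_eq)

text \<open>The homotopy principle for the polynomials w -> form (\<zeta> \<tau> + w x), whose
  coefficient at degree d is the constant p x.\<close>

lemma form_homotopy:
  fixes \<zeta> :: "real \<Rightarrow> 'a \<Rightarrow> complex"
  assumes "p x \<noteq> 0" and cont: "\<And>b. continuous_on {0..1} (\<lambda>\<tau>. \<zeta> \<tau> b)"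
    and real: "\<And>\<tau> s. \<tau> \<in> {0..1} \<Longrightarrow> form A c (\<lambda>b. \<zeta> \<tau> b + of_real s * of_real (x \<bullet> b)) \<noteq> 0"
    and start: "\<And>w. Im w \<ge> 0 \<Longrightarrow> form A c (\<lambda>b. \<zeta> 0 b + w * of_real (x \<bullet> b)) \<noteq> 0"
    and "Im w \<ge> 0"
  shows "form A c (\<lambda>b. \<zeta> 1 b + w * of_real (x \<bullet> b)) \<noteq> 0"
proof -
  define Q where "Q \<tau> = form_line_poly A c (\<zeta> \<tau>) (\<lambda>b. of_real (x \<bullet> b))" for \<tau>
  have "poly (Q 1) w \<noteq> 0"
  proof (rule upper_half_plane_homotopy[where d = d and l = "of_real (p x)"])
    show "degree (Q \<tau>) \<le> d" for \<tau>
      unfolding Q_def by (rule form_line_poly_top(1)) (rule homogeneous)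
    show "coeff (Q \<tau>) d = of_real (p x)" for \<tau>
      unfolding Q_def form_of_real_inner[symmetric] by (rule form_line_poly_top(2)) (rule homogeneous)
    show "continuous_on {0..1} (\<lambda>\<tau>. coeff (Q \<tau>) k)" for k
      unfolding Q_def
      by (rule coeff_form_line_poly_closed[where C = "continuous_on {0..1}"])
        (auto intro: continuous_intros cont)
  qed (use assms in \<open>auto simp: Q_def poly_form_line_poly\<close>)
  then show ?thesis
    by (simp add: Q_def poly_form_line_poly)
qed

text \<open>The number i a is not real, so \<open>real_zeros\<close> excludes it.\<close>

lemma form_nonzero_real_shift:
  assumes "a \<noteq> 0"
  shows "form A c (\<lambda>b. of_real (x \<bullet> b) + \<i> * of_real (a * (e \<bullet> b))) \<noteq> 0"
  using real_zeros[of x "\<i> * of_real a"] assms by (auto simp: complex_is_Real_iff mult_ac)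

lemma form_nonzero_open_cone:
  assumes "x \<in> open_cone" and "a > 0" and "Im w \<ge> 0"
  shows "form A c (\<lambda>b. \<i> * of_real (a * (e \<bullet> b)) + w * of_real (x \<bullet> b)) \<noteq> 0"
proof (cases "w = 0")
  case True
  have "form A c (\<lambda>b. (\<i> * of_real a) * of_real (e \<bullet> b)) = (\<i> * of_real a) ^ d * (of_real (p e) :: complex)"
    by (subst form_scale[OF homogeneous]) (simp_all add: form_of_real_inner)
  with True show ?thesis
    using assms p_e_pos by (simp add: mult_ac)
next
  case False
  \<comment> \<open>Dividing by \<open>w\<close> turns the point into w (x + u e). A zero forces u
    to be real, then negative as x lies in \<open>open_cone\<close>, and so w = i a / u would lie
    below the real axis.\<close>
  define u where "u = \<i> * of_real a / w"
  have "u \<noteq> 0" and w: "w = \<i> * of_real a / u"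
    using False assms by (auto simp: u_def)
  have eq: "form A c (\<lambda>b. \<i> * of_real (a * (e \<bullet> b)) + w * of_real (x \<bullet> b)) =
      w ^ d * form A c (\<lambda>b. of_real (x \<bullet> b) + u * of_real (e \<bullet> b))"
    by (subst form_scale[OF homogeneous, symmetric])
      (use False in \<open>simp_all add: u_def algebra_simps\<close>)
  have "form A c (\<lambda>b. of_real (x \<bullet> b) + u * of_real (e \<bullet> b)) \<noteq> 0"
  proof
    assume zero: "form A c (\<lambda>b. of_real (x \<bullet> b) + u * of_real (e \<bullet> b)) = 0"
    then obtain t where t: "u = of_real t"
      using real_zeros by (metis Reals_cases)
    have "of_real (p (x + t *\<^sub>R e)) = (0 :: complex)"
      using zero by (simp add: t inner_add_left flip: form_of_real_inner)
    then have "t < 0"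
      using assms(1) by (force simp: open_cone_def not_le [symmetric])
    then have "Im w < 0"
      using w t \<open>a > 0\<close> by (simp add: divide_pos_neg)
    with \<open>Im w \<ge> 0\<close> show False by simp
  qed
  with eq False show ?thesis by simp
qed

text \<open>The real shift grows from 0 to \<open>y\<close>. For real parameters s the point is
  \<tau> y + s x + i a e, covered by \<open>form_nonzero_real_shift\<close>.\<close>

lemma form_nonzero_open_cone_real_shift:
  assumes "x \<in> open_cone" and "a > 0" and "Im w \<ge> 0"
  shows "form A c (\<lambda>b. of_real (y \<bullet> b) + \<i> * of_real (a * (e \<bullet> b)) + w * of_real (x \<bullet> b)) \<noteq> 0"
proof -
  define \<zeta> where "\<zeta> \<tau> b = (of_real (\<tau> * (y \<bullet> b)) + \<i> * of_real (a * (e \<bullet> b)) :: complex)" for \<tau> b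
  have "form A c (\<lambda>b. \<zeta> 1 b + w * of_real (x \<bullet> b)) \<noteq> 0"
  proof (rule form_homotopy)
    show "p x \<noteq> 0"
      using assms(1) by (force simp: open_cone_def)
    show "continuous_on {0..1} (\<lambda>\<tau>. \<zeta> \<tau> b)" for b
      unfolding \<zeta>_def by (intro continuous_intros)
    show "form A c (\<lambda>b. \<zeta> \<tau> b + of_real s * of_real (x \<bullet> b)) \<noteq> 0" for \<tau> s
      using form_nonzero_real_shift[of a "\<tau> *\<^sub>R y + s *\<^sub>R x"] assms(2)
      by (simp add: \<zeta>_def inner_add_left algebra_simps)
  qed (use assms form_nonzero_open_cone in \<open>auto simp: \<zeta>_def\<close>)
  then show ?thesis by (simp add: \<zeta>_def)
qed

text \<open>The term i g x is switched on gradually. For real s the vector s z serves as the real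
  shift of the preceding lemma, with w = i \<tau> g.\<close>

lemma form_nonzero_open_cone_pair:
  assumes "x \<in> open_cone" and "z \<in> open_cone" and "a > 0" and "g \<ge> 0" and "Im w \<ge> 0"
  shows "form A c (\<lambda>b. \<i> * of_real (a * (e \<bullet> b)) + \<i> * of_real (g * (x \<bullet> b)) + w * of_real (z \<bullet> b)) \<noteq> 0"
proof -
  define \<zeta> where
    "\<zeta> \<tau> b = (\<i> * of_real (a * (e \<bullet> b)) + \<i> * of_real (\<tau> * g * (x \<bullet> b)) :: complex)" for \<tau> b
  have "form A c (\<lambda>b. \<zeta> 1 b + w * of_real (z \<bullet> b)) \<noteq> 0"
  proof (rule form_homotopy)
    show "p z \<noteq> 0"
      using assms(2) by (force simp: open_cone_def)
    show "continuous_on {0..1} (\<lambda>\<tau>. \<zeta> \<tau> b)" for b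
      unfolding \<zeta>_def by (intro continuous_intros)
    show "form A c (\<lambda>b. \<zeta> \<tau> b + of_real s * of_real (z \<bullet> b)) \<noteq> 0" if "\<tau> \<in> {0..1}" for \<tau> s
      using form_nonzero_open_cone_real_shift[of x a "\<i> * of_real (\<tau> * g)" "s *\<^sub>R z"] assms that
      by (simp add: \<zeta>_def algebra_simps)
  qed (use assms form_nonzero_open_cone in \<open>auto simp: \<zeta>_def\<close>)
  then show ?thesis by (simp add: \<zeta>_def)
qed

text \<open>At w = i h all coordinates of the preceding lemma are i times real ones, and homogeneity
  pulls out i ^ d.\<close>

lemma p_nonzero_open_cone_combination:
  assumes "x \<in> open_cone" and "z \<in> open_cone" and "a > 0" and "g \<ge> 0" and "h \<ge> 0"
  shows "p (a *\<^sub>R e + g *\<^sub>R x + h *\<^sub>R z) \<noteq> 0"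
proof
  assume "p (a *\<^sub>R e + g *\<^sub>R x + h *\<^sub>R z) = 0"
  then have "form A c (\<lambda>b. \<i> * of_real ((a *\<^sub>R e + g *\<^sub>R x + h *\<^sub>R z) \<bullet> b)) = (0 :: complex)"
    by (subst form_scale[OF homogeneous]) (simp_all add: form_of_real_inner)
  then show False
    using form_nonzero_open_cone_pair[of x z a g "\<i> * of_real h"] assms
    by (simp add: inner_add_left algebra_simps)
qed

lemma cone_add_direction: "x \<in> cone \<Longrightarrow> \<epsilon> > 0 \<Longrightarrow> x + \<epsilon> *\<^sub>R e \<in> open_cone"
  by (auto simp: cone_def open_cone_def add.assoc simp flip: scaleR_add_left)

lemma cone_add_scaleR:
  assumes "z \<in> cone" and "x \<in> cone" and "s \<ge> 0"
  shows "z + s *\<^sub>R x \<in> cone"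
  unfolding cone_def mem_Collect_eq
proof (intro allI impI)
  fix t :: real assume "t > 0"
  \<comment> \<open>Half of t e is kept as the multiple of e; the other half equals (1 + s)
    \<epsilon> e and moves both \<open>x\<close> and \<open>z\<close> into
    \<open>open_cone\<close>.\<close>
  define \<epsilon> where "\<epsilon> = t / (2 * (1 + s))"
  have "\<epsilon> > 0"
    using \<open>t > 0\<close> \<open>s \<ge> 0\<close> by (simp add: \<epsilon>_def)
  have "(1 + s) * \<epsilon> = t / 2"
    using \<open>s \<ge> 0\<close> by (simp add: \<epsilon>_def divide_simps)
  then have t: "t = t / 2 + (s * \<epsilon> + \<epsilon>)"
    by (simp add: algebra_simps)
  have "p ((t / 2) *\<^sub>R e + s *\<^sub>R (x + \<epsilon> *\<^sub>R e) + 1 *\<^sub>R (z + \<epsilon> *\<^sub>R e)) \<noteq> 0"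
    using assms \<open>t > 0\<close> \<open>\<epsilon> > 0\<close> by (intro p_nonzero_open_cone_combination cone_add_direction) auto
  also have "(t / 2) *\<^sub>R e + s *\<^sub>R (x + \<epsilon> *\<^sub>R e) + 1 *\<^sub>R (z + \<epsilon> *\<^sub>R e) =
      z + s *\<^sub>R x + (t / 2 + (s * \<epsilon> + \<epsilon>)) *\<^sub>R e"
    by (simp add: algebra_simps)
  finally show "p (z + s *\<^sub>R x + t *\<^sub>R e) \<noteq> 0"
    by (simp flip: t)
qed

lemma cone_scaleR:
  assumes "z \<in> cone" and "k > 0"
  shows "k *\<^sub>R z \<in> cone"
  unfolding cone_def mem_Collect_eq
proof (intro allI impI)
  fix t :: real assume "t > 0"
  have "k *\<^sub>R z + t *\<^sub>R e = k *\<^sub>R (z + (t / k) *\<^sub>R e)"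
    using assms by (simp add: algebra_simps)
  then show "p (k *\<^sub>R z + t *\<^sub>R e) \<noteq> 0"
    using assms \<open>t > 0\<close> by (simp add: p_scale cone_def)
qed

section \<open>Directional derivatives on the cone\<close>

text \<open>Oriented as x + t e to match \<open>dir_deriv\<close>; \<open>line_poly\<close> runs in
  the opposite direction.\<close>

definition e_line :: "'a \<Rightarrow> real poly" where
  "e_line x = form_line_poly A c (\<lambda>b. x \<bullet> b) (\<lambda>b. e \<bullet> b)"

lemma poly_e_line: "poly (e_line x) t = p (x + t *\<^sub>R e)"
  by (simp add: e_line_def poly_form_line_poly p_eq inner_add_left)

lemma e_line_top: "degree (e_line x) = d" "lead_coeff (e_line x) = p e"
proof -
  have "degree (e_line x) \<le> d" and coeff: "coeff (e_line x) d = p e"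
    using form_line_poly_top[where \<zeta> = "\<lambda>b. x \<bullet> b" and \<xi> = "\<lambda>b. e \<bullet> b", OF homogeneous]
    by (simp_all add: e_line_def p_eq)
  then show "degree (e_line x) = d"
    using p_e_pos by (intro antisym le_degree) auto
  with coeff show "lead_coeff (e_line x) = p e" by simp
qed

lemma only_real_roots_e_line: "only_real_roots (e_line x)"
  unfolding only_real_roots_def
  using real_zeros by (auto simp: e_line_def map_poly_form_line_poly poly_form_line_poly)

lemma coeff_e_line_nonneg:
  assumes "x \<in> cone"
  shows "coeff (e_line x) k \<ge> 0"
proof (rule only_real_roots_coeff_nonneg)
  show "poly (e_line x) t \<noteq> 0" if "t > 0" for t
    using assms that by (simp add: poly_e_line cone_def)
  show "lead_coeff (e_line x) \<ge> 0"
    unfolding e_line_top(2) using p_e_pos by simp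
qed (rule only_real_roots_e_line)

end

section \<open>Iterated derivatives and Taylor coefficients\<close>

lemma funpow_deriv_poly:
  "(deriv ^^ k) (\<lambda>t. poly q (s + t)) = (\<lambda>t. poly ((pderiv ^^ k) q) (s + t :: real))"
proof (induction k)
  case (Suc k)
  have "((\<lambda>t. poly q' (s + t)) has_field_derivative poly (pderiv q') (s + t)) (at t)" for q' t
    by (rule derivative_eq_intros poly_DERIV[THEN DERIV_chain2] refl | simp)+
  with Suc show ?case
    by (auto intro!: DERIV_imp_deriv)
qed auto

lemma poly_funpow_pderiv_0: "poly ((pderiv ^^ k) q) 0 = fact k * coeff q k"
  by (induction k arbitrary: q) (simp_all add: poly_0_coeff_0 funpow_Suc_right coeff_pderiv mult_ac del: funpow.simps(2))

context hyperbolic_form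
begin

lemma dir_deriv_shift: "dir_deriv e k p (x + s *\<^sub>R e) = poly ((pderiv ^^ k) (e_line x)) s"
proof -
  have "(\<lambda>t. p (x + s *\<^sub>R e + t *\<^sub>R e)) = (\<lambda>t. poly (e_line x) (s + t))"
    by (simp add: poly_e_line algebra_simps)
  then show ?thesis
    by (simp add: dir_deriv_def funpow_deriv_poly)
qed

lemma dir_deriv_eq_coeff: "dir_deriv e k p x = fact k * coeff (e_line x) k"
  using dir_deriv_shift[of k x 0] by (simp add: poly_funpow_pderiv_0)

lemma dir_deriv_nonneg: "x \<in> cone \<Longrightarrow> dir_deriv e k p x \<ge> 0"
  by (simp add: dir_deriv_eq_coeff coeff_e_line_nonneg)

text \<open>Up to a factorial this is a coefficient of \<open>e_line\<close>, which is polynomial in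
  the coordinates of the point.\<close>

lemma dir_deriv_differentiable: "dir_deriv e k p differentiable (at x)"
proof -
  have "(\<lambda>y. coeff (e_line y) k) differentiable (at x)"
    unfolding e_line_def
    by (rule coeff_form_line_poly_closed[where C = "\<lambda>f. f differentiable (at x)"])
      (simp_all add: bounded_linear_imp_differentiable bounded_linear_inner_left)
  then have "(\<lambda>y. fact k * coeff (e_line y) k) differentiable (at x)"
    by (rule differentiable_mult[OF differentiable_const])
  then show ?thesis
    by (simp add: dir_deriv_eq_coeff [abs_def])
qed

end

section \<open>Gradients and one-sided directional derivatives\<close>

lemma differentiable_imp_GDERIV:
  fixes f :: "'a::euclidean_space \<Rightarrow> real"
  assumes "f differentiable (at x)"
  shows "GDERIV f x :> gradient f x"
proof -
  obtain f' where f': "(f has_derivative f') (at x)"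
    using assms by (auto simp: differentiable_def)
  \<comment> \<open>The adjoint at 1 is the vector that represents the linear functional
    \<open>f'\<close>.\<close>
  then have "f' = (\<lambda>h. h \<bullet> adjoint f' 1)"
    using adjoint_works[of f' _ 1] by (simp add: has_derivative_linear fun_eq_iff)
  with f' have "GDERIV f x :> adjoint f' 1"
    by (simp add: gderiv_def)
  then show ?thesis
    using gradient_eqI by metis
qed

lemma GDERIV_directional:
  assumes "GDERIV f x :> D"
  shows "((\<lambda>s. f (x + s *\<^sub>R h)) has_real_derivative h \<bullet> D) (at 0)"
proof -
  have "((\<lambda>s. f (x + s *\<^sub>R h)) has_derivative (\<lambda>s. (s *\<^sub>R h) \<bullet> D)) (at 0)"
    by (rule has_derivative_compose[where g = f and f = "\<lambda>s. x + s *\<^sub>R h"])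
      (use assms in \<open>auto simp: gderiv_def intro!: derivative_eq_intros\<close>)
  then show ?thesis
    by (simp add: has_field_derivative_def mult.commute[of _ "h \<bullet> D"])
qed

text \<open>A negative directional derivative would push f below f x = 0 immediately to the right of
  s = 0.\<close>

lemma GDERIV_inner_nonneg:
  assumes "GDERIV f x :> D" and "f x = 0" and "\<delta> > 0"
    and "\<And>s. 0 < s \<Longrightarrow> s < \<delta> \<Longrightarrow> f (x + s *\<^sub>R h) \<ge> 0"
  shows "h \<bullet> D \<ge> 0"
proof (rule ccontr)
  assume "\<not> h \<bullet> D \<ge> 0"
  then have "h \<bullet> D < 0" by simp
  from DERIV_neg_dec_right[OF GDERIV_directional[OF assms(1)] this] obtain \<epsilon>
    where "\<epsilon> > 0" and neg: "\<And>s. 0 < s \<Longrightarrow> s < \<epsilon> \<Longrightarrow> f (x + s *\<^sub>R h) < f x"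
    by auto
  define s where "s = min \<delta> \<epsilon> / 2"
  have "0 < s" "s < \<delta>" "s < \<epsilon>"
    using \<open>\<delta> > 0\<close> \<open>\<epsilon> > 0\<close> by (auto simp: s_def)
  then show False
    using neg[of s] assms(2) assms(4)[of s] by simp
qed

section \<open>Hyperbolic polynomials\<close>

lemma hyperbolic_imp_form:
  assumes "hyperbolic d p e" and "p e > 0"
  obtains A c where "hyperbolic_form A c d p e"
proof -
  obtain A :: "('a \<Rightarrow> nat) set" and c where
    deg: "\<forall>\<alpha>\<in>A. (\<Sum>b\<in>Basis. \<alpha> b) = d" and
    p: "\<And>x. p x = form A c (\<lambda>b. x \<bullet> b)"
    using assms unfolding hyperbolic_def homogeneous_polynomial_def form_def by auto
  have line: "line_poly p e x = form_line_poly A c (\<lambda>b. x \<bullet> b) (\<lambda>b. - (e \<bullet> b))" for x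
    using assms(1)
    by (intro poly_eq_poly_eq_iff[THEN iffD1] ext)
      (simp add: hyperbolic_def poly_line_poly[of d] poly_form_line_poly p inner_diff_left)
  have "w \<in> \<real>" if "form A c (\<lambda>b. of_real (x \<bullet> b) + w * of_real (e \<bullet> b)) = 0" for x and w :: complex
  proof -
    \<comment> \<open>The sign changes because \<open>line_poly\<close> follows x - t e.\<close>
    have "poly (map_poly of_real (line_poly p e x)) (- w) = 0"
      using that by (simp add: line map_poly_form_line_poly poly_form_line_poly)
    then have "- w \<in> \<real>"
      using assms(1) unfolding hyperbolic_def only_real_roots_def by blast
    then show ?thesis by simp
  qed
  with deg p assms(2) have "hyperbolic_form A c d p e"
    by unfold_locales auto
  then show ?thesis by (rule that)
qed

section \<open>Eigenvalues and multiplicity in terms of the polynomial along e\<close>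

context hyperbolic_form
begin

lemma line_poly_eq:
  assumes "hyperbolic d p e"
  shows "line_poly p e x = e_line x \<circ>\<^sub>p [:0, - 1:]"
  using assms
  by (intro poly_eq_poly_eq_iff[THEN iffD1] ext)
    (simp add: hyperbolic_def poly_line_poly[of d] poly_e_line poly_pcompose)

lemma hyp_cone_subset_cone:
  assumes "hyperbolic d p e"
  shows "hyp_cone d p e \<subseteq> cone"
proof
  fix x assume x: "x \<in> hyp_cone d p e"
  define q where "q = line_poly p e x"
  define xs where "xs = sorted_list_of_multiset (proots q)"
  have deg: "degree q = d"
    by (simp add: q_def line_poly_eq[OF assms] degree_pcompose e_line_top)
  have poly_q: "poly q t = p (x - t *\<^sub>R e)" for t
    by (simp add: q_def line_poly_eq[OF assms] poly_pcompose poly_e_line)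
  have "size (proots q) = d"
    using assms deg by (simp add: q_def hyperbolic_def size_proots_only_real_roots)
  then have len: "length xs = d"
    by (simp add: xs_def flip: size_mset)
  have "p (x + t *\<^sub>R e) \<noteq> 0" if "t > 0" for t
  proof
    assume zero: "p (x + t *\<^sub>R e) = 0"
    have "coeff q d \<noteq> 0"
      using e_line_top[of x] p_e_pos by (simp add: q_def line_poly_eq[OF assms] coeff_pcompose_linear)
    then have "q \<noteq> 0" by auto
    with zero have "- t \<in> set xs"
      using poly_q[of "- t"] by (simp add: xs_def)
    then obtain i where i: "i < d" "xs ! i = - t"
      by (metis in_set_conv_nth len)
    \<comment> \<open>The list is ascending, so its first entry is the smallest eigenvalue; i < d
      gives d > 0.\<close>
    have "rev xs ! (d - 1) = xs ! 0"
      using i len by (simp add: rev_nth)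
    moreover have "rev xs ! (d - 1) \<ge> 0"
      using x by (simp add: hyp_cone_def eigenvalue_def eigenvalues_def q_def xs_def)
    moreover have "xs ! 0 \<le> xs ! i"
      using i len by (intro sorted_nth_mono) (auto simp: xs_def)
    ultimately show False
      using i that by simp
  qed
  then show "x \<in> cone"
    by (simp add: cone_def)
qed

text \<open>The order of the root 0 is the index of the first nonzero coefficient, and reflecting
  the line changes coefficients only by signs.\<close>

lemma coeff_e_line_hyp_mult:
  assumes "hyperbolic d p e"
  shows "k < hyp_mult p e z \<Longrightarrow> coeff (e_line z) k = 0"
    and "coeff (e_line z) (hyp_mult p e z) \<noteq> 0"
proof -
  define q where "q = line_poly p e z"
  have coeff: "coeff q k = (- 1) ^ k * coeff (e_line z) k" for k
    by (simp add: q_def line_poly_eq[OF assms] coeff_pcompose_linear)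
  have "coeff q d \<noteq> 0"
    using coeff[of d] e_line_top[of z] p_e_pos by simp
  then have "q \<noteq> 0" by auto
  then have r: "hyp_mult p e z = order 0 q"
    by (simp add: hyp_mult_def eigenvalues_def q_def)
  have dvd: "n \<le> order 0 q \<longleftrightarrow> (\<forall>k<n. coeff q k = 0)" for n
    using \<open>q \<noteq> 0\<close> monom_1_dvd_iff monom_1_dvd_iff' by metis
  show "k < hyp_mult p e z \<Longrightarrow> coeff (e_line z) k = 0"
    using dvd[of "order 0 q"] coeff[of k] r by simp
  show "coeff (e_line z) (hyp_mult p e z) \<noteq> 0"
    using dvd[of "order 0 q"] dvd[of "Suc (order 0 q)"] coeff[of "order 0 q"] r
    by (auto simp: less_Suc_eq)
qed

text \<open>The derivative along e is computed twice: through the gradient, and as one more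
  derivative of the univariate polynomial.\<close>

lemma gradient_dir_deriv_inner_direction:
  "e \<bullet> gradient (dir_deriv e k p) z = fact (Suc k) * coeff (e_line z) (Suc k)"
proof -
  have "((\<lambda>s. dir_deriv e k p (z + s *\<^sub>R e)) has_real_derivative
      e \<bullet> gradient (dir_deriv e k p) z) (at 0)"
    by (intro GDERIV_directional differentiable_imp_GDERIV dir_deriv_differentiable)
  moreover have "((\<lambda>s. dir_deriv e k p (z + s *\<^sub>R e)) has_real_derivative
      poly ((pderiv ^^ Suc k) (e_line z)) 0) (at 0)"
    unfolding dir_deriv_shift using poly_DERIV[of "(pderiv ^^ k) (e_line z)" 0] by simp
  ultimately show ?thesis
    using poly_funpow_pderiv_0[of "Suc k" "e_line z"] by (metis DERIV_unique)
qed

end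

theorem proposition4p4:
  fixes p :: "'a::euclidean_space \<Rightarrow> real" and e z :: 'a and d r :: nat
  assumes "hyperbolic d p e"
    and "p e > 0"
    and "z \<in> hyp_cone d p e"
    and "hyp_mult p e z \<ge> 1"
    and "r = hyp_mult p e z"
  shows "gradient (dir_deriv e (r - 1) p) z \<in> conjugate_face (hyp_cone d p e) z - {0}"
proof -
  obtain A c where "hyperbolic_form A c d p e"
    using assms(1,2) by (rule hyperbolic_imp_form)
  then interpret hyperbolic_form A c d p e .
  define f where "f = dir_deriv e (r - 1) p"
  have grad: "GDERIV f z :> gradient f z"
    unfolding f_def by (intro differentiable_imp_GDERIV dir_deriv_differentiable)
  have "f z = 0"
    using assms coeff_e_line_hyp_mult(1)[of "r - 1" z] by (simp add: f_def dir_deriv_eq_coeff)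
  have z: "z \<in> cone"
    using assms hyp_cone_subset_cone by auto
  have nonneg: "x \<bullet> gradient f z \<ge> 0" if "x \<in> hyp_cone d p e" for x
    using that z assms(1) hyp_cone_subset_cone
    by (intro GDERIV_inner_nonneg[OF grad \<open>f z = 0\<close>, of 1])
      (auto simp: f_def intro!: dir_deriv_nonneg cone_add_scaleR)
  \<comment> \<open>For 0 < s < 1 the point z - s z is a positive multiple of z. Together with the
    direction z itself this gives orthogonality.\<close>
  have "(- z) \<bullet> gradient f z \<ge> 0"
  proof (rule GDERIV_inner_nonneg[OF grad \<open>f z = 0\<close>, of 1])
    fix s :: real assume "0 < s" "s < 1"
    then have "(1 - s) *\<^sub>R z \<in> cone"
      using z by (intro cone_scaleR) auto
    then show "f (z + s *\<^sub>R (- z)) \<ge> 0"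
      using dir_deriv_nonneg by (simp add: f_def algebra_simps)
  qed simp
  with nonneg[OF assms(3)] have "gradient f z \<bullet> z = 0"
    by (simp add: inner_commute)
  \<comment> \<open>As r >= 1, \<open>Suc (r - 1)\<close> is r, so the inner product with e is r!
    times the first nonzero coefficient.\<close>
  moreover have "gradient f z \<noteq> 0"
    using gradient_dir_deriv_inner_direction[of "r - 1" z] coeff_e_line_hyp_mult(2)[OF assms(1), of z] assms(4,5)
    by (auto simp: f_def)
  ultimately show ?thesis
    using nonneg by (auto simp: f_def conjugate_face_def dual_cone_def)
qed

end
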